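(* Let $E_h \in C^1((0,T); V_{0,h})$ and $K_h \in C^1((0,T); V_{\frac12,h})$ be a solution of the one-dimensional semi-discrete (discrete in space, continuous in time) system $$\partial_{tt} E_h - c^2\, \mathrm{curl}^{(4)}_{h,\ast}\, \mathrm{curl}^{(4)}_{h} E_h + \omega_{pe}^2 E_h = c^2\, \mathrm{curl}^{(4)}_{h,\ast} K_h, \qquad \partial_{tt} K_h + \omega_{pm}^2 K_h = -\omega_{pm}^2\, \mathrm{curl}^{(4)}_{h} E_h .$$ Then $$\frac{d\mathcal{E}_{h,EK}}{dt} = 0,$$ where $$\mathcal{E}_{h,EK} = \frac{1}{2}\Bigl( \frac{1}{c^2}\|\partial_t E_h\|_{0,h}^2 + \frac{1}{\omega_{pm}^2}\|\partial_t K_h\|_{\frac12,h}^2 + \frac{\omega_{pe}^2}{c^2}\|E_h\|_{0,h}^2 + \|K_h + \mathrm{curl}_h^{(4)}E_h\|_{\frac12,h}^2 \Bigr).$$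
   Context: Constants: $\varepsilon_0,\mu_0,\omega_{pe},\omega_{pm}>0$, $c=1/\sqrt{\varepsilon_0\mu_0}$, $T>0$. The interval $\Omega=[0,L]$ is discretized with $M\in\mathbb{N}$, $M\ge 1$, $h=L/M$. The primal grid points are $x_\ell=\ell h$ and the dual grid points are $x_{\ell+\frac12}=(\ell+\frac12)h$. With periodic boundary conditions, $V_{0,h}$ is the space of real grid functions $v_h=(v_\ell)_{\ell}$ on the primal grid and $V_{\frac12,h}$ the space of real grid functions $u_h=(u_{\ell+\frac12})_{\ell}$ on the dual grid, with indices $\ell$ understood modulo $M$ ($v_{\ell+M}=v_\ell$, $u_{\ell+M+\frac12}=u_{\ell+\frac12}$). The inner products are $\langle v,w\rangle_{0,h}=h\sum_{\ell=0}^{M-1}v_\ell w_\ell$ and $\langle u,z\rangle_{\frac12,h}=h\sum_{\ell=0}^{M-1}u_{\ell+\frac12}z_{\ell+\frac12}$, with associated norms $\|\cdot\|_{0,h}$, $\|\cdot\|_{\frac12,h}$. The fourth order staggered difference operators $\mathrm{curl}_h^{(4)}:V_{0,h}\to V_{\frac12,h}$ and $\mathrm{curl}_{h,\ast}^{(4)}:V_{\frac12,h}\to V_{0,h}$ are $$(\mathrm{curl}_h^{(4)}v)_{\ell+\frac12}=\frac98\frac{v_{\ell+1}-v_\ell}{h}-\frac1{24}\frac{v_{\ell+2}-v_{\ell-1}}{h},\qquad (\mathrm{curl}_{h,\ast}^{(4)}u)_{\ell}=\frac98\frac{u_{\ell+\frac12}-u_{\ell-\frac12}}{h}-\frac1{24}\frac{u_{\ell+\frac32}-u_{\ell-\frac32}}{h}.$$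 *)

theory Defs
  imports "HOL-Analysis.Analysis"
begin

text \<open>
  A grid function with periodic boundary conditions on \<open>M\<close> cells is an \<open>M\<close>-periodic function of
  an integer index. Both grids use this representation: for a primal grid function, \<open>v l\<close> is the
  value at \<open>l h\<close>; for a dual grid function, \<open>u l\<close> is the value at \<open>(l + 1/2) h\<close>. Hence
  \<open>grid_space M\<close> represents both the primal and the dual space, and the half-integer indices
  \<open>l - 3/2, l - 1/2, l + 1/2, l + 3/2\<close> of a dual function appear as \<open>l - 2, l - 1, l, l + 1\<close>.
\<close>

type_synonym grid_fun = "int \<Rightarrow> real"

definition grid_space :: "nat \<Rightarrow> grid_fun set" where
  "grid_space M = {v. \<forall>l. v (l + int M) = v l}"

definition grid_inner :: "real \<Rightarrow> nat \<Rightarrow> grid_fun \<Rightarrow> grid_fun \<Rightarrow> real" where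
  "grid_inner h M v w = h * (\<Sum>l\<in>{0..<int M}. v l * w l)"

definition grid_norm :: "real \<Rightarrow> nat \<Rightarrow> grid_fun \<Rightarrow> real" where
  "grid_norm h M v = sqrt (grid_inner h M v v)"

text \<open>\<open>curl4\<close> maps primal to dual grid functions, \<open>curl4_star\<close> maps dual to primal ones.\<close>

definition curl4 :: "real \<Rightarrow> grid_fun \<Rightarrow> grid_fun" where
  "curl4 h v = (\<lambda>l. 9/8 * ((v (l + 1) - v l) / h) - 1/24 * ((v (l + 2) - v (l - 1)) / h))"

definition curl4_star :: "real \<Rightarrow> grid_fun \<Rightarrow> grid_fun" where
  "curl4_star h u = (\<lambda>l. 9/8 * ((u l - u (l - 1)) / h) - 1/24 * ((u (l + 1) - u (l - 2)) / h))"

text \<open>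
  Time derivatives and time regularity are taken at each grid point. As the grid spaces are
  finite-dimensional, this agrees with differentiation in the grid norm; see
  \<open>grid_derivative_iff_norm\<close> below.
\<close>

definition dt :: "(real \<Rightarrow> grid_fun) \<Rightarrow> real \<Rightarrow> grid_fun" where
  "dt E t = (\<lambda>l. deriv (\<lambda>s. E s l) t)"

definition grid_differentiable_on :: "(real \<Rightarrow> grid_fun) \<Rightarrow> real set \<Rightarrow> bool" where
  "grid_differentiable_on E S \<longleftrightarrow> (\<forall>t\<in>S. \<forall>l. (\<lambda>s. E s l) differentiable (at t))"

definition grid_C1 :: "nat \<Rightarrow> real set \<Rightarrow> (real \<Rightarrow> grid_fun) set" where
  "grid_C1 M S = {E. (\<forall>t\<in>S. E t \<in> grid_space M) \<and> (\<forall>l. (\<lambda>t. E t l) C1_differentiable_on S)}"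

definition energy_EK ::
  "real \<Rightarrow> nat \<Rightarrow> real \<Rightarrow> real \<Rightarrow> real \<Rightarrow> (real \<Rightarrow> grid_fun) \<Rightarrow> (real \<Rightarrow> grid_fun) \<Rightarrow> real \<Rightarrow> real" where
  "energy_EK h M c \<omega>\<^sub>p\<^sub>e \<omega>\<^sub>p\<^sub>m E K t =
     1/2 * (1 / c\<^sup>2 * (grid_norm h M (dt E t))\<^sup>2
          + 1 / \<omega>\<^sub>p\<^sub>m\<^sup>2 * (grid_norm h M (dt K t))\<^sup>2
          + \<omega>\<^sub>p\<^sub>e\<^sup>2 / c\<^sup>2 * (grid_norm h M (E t))\<^sup>2
          + (grid_norm h M (\<lambda>l. K t l + curl4 h (E t) l))\<^sup>2)"

lemma grid_space_mod:
  assumes "v \<in> grid_space M"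
  shows "v (l mod int M) = v l"
proof -
  have nat: "v (k + int n * int M) = v k" for k n
  proof (induction n)
    case (Suc n)
    have "v (k + int (Suc n) * int M) = v ((k + int n * int M) + int M)"
      by (simp add: algebra_simps)
    also have "\<dots> = v k"
      using assms Suc by (simp add: grid_space_def)
    finally show ?case .
  qed simp
  have "v (k + q * int M) = v k" for k q
  proof (cases "q \<ge> 0")
    case True
    then show ?thesis using nat[of k "nat q"] by simp
  next
    case False
    then show ?thesis using nat[of "k + q * int M" "nat (- q)"] by simp
  qed
  from this[of "l mod int M" "l div int M"] show ?thesis
    by (metis mod_div_mult_eq)
qed

lemma curl4_in_grid_space: "v \<in> grid_space M \<Longrightarrow> curl4 h v \<in> grid_space M"
  and curl4_star_in_grid_space: "u \<in> grid_space M \<Longrightarrow> curl4_star h u \<in> grid_space M"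
proof -
  have shift: "w (l + int M + 1) = w (l + 1)" "w (l + int M + 2) = w (l + 2)"
    "w (l + int M - 1) = w (l - 1)" "w (l + int M - 2) = w (l - 2)" "w (l + int M) = w l"
    if "w \<in> grid_space M" for w l
  proof -
    have w: "w (i + int M) = w i" for i
      using that by (simp add: grid_space_def)
    show "w (l + int M + 1) = w (l + 1)" "w (l + int M + 2) = w (l + 2)"
      "w (l + int M - 1) = w (l - 1)" "w (l + int M - 2) = w (l - 2)" "w (l + int M) = w l"
      using w[of "l + 1"] w[of "l + 2"] w[of "l - 1"] w[of "l - 2"] w[of l]
      by (simp_all only: ac_simps diff_conv_add_uminus)
  qed
  show "curl4 h v \<in> grid_space M" if "v \<in> grid_space M"
    unfolding grid_space_def curl4_def by (simp only: mem_Collect_eq shift[OF that] simp_thms)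
  show "curl4_star h u \<in> grid_space M" if "u \<in> grid_space M"
    unfolding grid_space_def curl4_star_def by (simp only: mem_Collect_eq shift[OF that] simp_thms)
qed

lemma grid_derivative_iff_norm:
  assumes "h > 0" "M \<ge> 1" "open S" "t \<in> S"
    and E: "\<And>s. s \<in> S \<Longrightarrow> E s \<in> grid_space M" and D: "D \<in> grid_space M"
  shows "(\<forall>l. ((\<lambda>s. E s l) has_real_derivative D l) (at t)) \<longleftrightarrow>
    ((\<lambda>s. grid_norm h M (\<lambda>l. (E s l - E t l) / (s - t) - D l)) \<longlongrightarrow> 0) (at t)"
proof
  let ?q = "\<lambda>s l. (E s l - E t l) / (s - t) - D l"
  assume "\<forall>l. ((\<lambda>s. E s l) has_real_derivative D l) (at t)"
  then have "((\<lambda>s. ?q s l) \<longlongrightarrow> 0) (at t)" for l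
    by (simp add: has_field_derivative_iff LIM_zero_iff)
  then have "((\<lambda>s. sqrt (h * (\<Sum>l\<in>{0..<int M}. ?q s l * ?q s l)))
      \<longlongrightarrow> sqrt (h * (\<Sum>l\<in>{0..<int M}. 0 * 0))) (at t)"
    by (intro tendsto_intros)
  then show "((\<lambda>s. grid_norm h M (?q s)) \<longlongrightarrow> 0) (at t)"
    by (simp add: grid_norm_def grid_inner_def)
next
  let ?q = "\<lambda>s l. (E s l - E t l) / (s - t) - D l"
  assume lim: "((\<lambda>s. grid_norm h M (?q s)) \<longlongrightarrow> 0) (at t)"
  have *: "((\<lambda>s. ?q s l) \<longlongrightarrow> 0) (at t)" if l: "l \<in> {0..<int M}" for l
  proof (rule Lim_null_comparison)
    show "\<forall>\<^sub>F s in at t. norm (?q s l) \<le> grid_norm h M (?q s) / sqrt h"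
    proof (intro always_eventually allI)
      fix s
      have "?q s l * ?q s l \<le> (\<Sum>l\<in>{0..<int M}. ?q s l * ?q s l)"
        by (rule member_le_sum[OF l]) auto
      then have "sqrt (?q s l * ?q s l) \<le> sqrt (\<Sum>l\<in>{0..<int M}. ?q s l * ?q s l)"
        by (rule real_sqrt_le_mono)
      then show "norm (?q s l) \<le> grid_norm h M (?q s) / sqrt h"
        using \<open>h > 0\<close> by (simp add: grid_norm_def grid_inner_def real_sqrt_mult)
    qed
    show "((\<lambda>s. grid_norm h M (?q s) / sqrt h) \<longlongrightarrow> 0) (at t)"
      using tendsto_divide[OF lim tendsto_const[of "sqrt h"]] \<open>h > 0\<close> by simp
  qed
  show "\<forall>l. ((\<lambda>s. E s l) has_real_derivative D l) (at t)"
  proof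
    fix l
    let ?k = "l mod int M"
    have "((\<lambda>s. ?q s ?k) \<longlongrightarrow> 0) (at t)"
      using \<open>M \<ge> 1\<close> by (intro *) simp
    then have "((\<lambda>s. E s ?k) has_real_derivative D ?k) (at t)"
      by (simp add: has_field_derivative_iff LIM_zero_iff)
    then show "((\<lambda>s. E s l) has_real_derivative D l) (at t)"
      using grid_space_mod[OF D, of l] grid_space_mod[OF E, of _ l] \<open>open S\<close> \<open>t \<in> S\<close>
      by (auto intro: has_field_derivative_transform_within_open)
  qed
qed

end

theory Submission
  imports Defs
begin

text \<open>
  The operators \<open>curl4\<close> and \<open>- curl4_star\<close> are adjoint with respect to the periodic inner products.
  Put \<open>W = K + curl4 E\<close>, so that the system reads
  \<open>E'' = c\<^sup>2 curl4_star W - \<omega>\<^sub>p\<^sub>e\<^sup>2 E\<close> and \<open>K'' = - \<omega>\<^sub>p\<^sub>m\<^sup>2 W\<close>. Testing the first equation with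
  \<open>E' / c\<^sup>2\<close> and the second with \<open>K' / \<omega>\<^sub>p\<^sub>m\<^sup>2\<close>, everything in the derivative of the energy cancels
  except \<open>\<langle>E', curl4_star W\<rangle> + \<langle>W, curl4 E'\<rangle>\<close>, which vanishes by adjointness.
\<close>

lemma grid_norm_squared: "h \<ge> 0 \<Longrightarrow> (grid_norm h M v)\<^sup>2 = grid_inner h M v v"
  by (simp add: grid_norm_def grid_inner_def sum_nonneg)

lemma grid_inner_commute: "grid_inner h M v w = grid_inner h M w v"
  by (simp add: grid_inner_def mult.commute)

lemma grid_inner_add_right:
  "grid_inner h M u (\<lambda>l. v l + w l) = grid_inner h M u v + grid_inner h M u w"
  by (simp add: grid_inner_def distrib_left sum.distrib)

lemma grid_inner_diff_right:
  "grid_inner h M u (\<lambda>l. v l - w l) = grid_inner h M u v - grid_inner h M u w"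
  by (simp add: grid_inner_def right_diff_distrib sum_subtractf)

lemma grid_inner_scale_right:
  "grid_inner h M u (\<lambda>l. a * v l) = a * grid_inner h M u v"
  by (simp add: grid_inner_def sum_distrib_left mult.left_commute)

lemma curl4_star_add: "curl4_star h (\<lambda>l. u l + v l) l = curl4_star h u l + curl4_star h v l"
  by (simp add: curl4_star_def add_divide_distrib diff_divide_distrib algebra_simps)

text \<open>Telescoping leaves only the two end values, and periodicity identifies them: no boundary
  term survives.\<close>

lemma sum_telescope_periodic:
  assumes "F \<in> grid_space M"
  shows "(\<Sum>l\<in>{0..<int M}. F (l + 1) - F l) = 0"
proof -
  have "(\<Sum>l\<in>{0..<int n}. F (l + 1) - F l) = F (int n) - F 0" for n
  proof (induction n)
    case (Suc n)
    have "{0..<int (Suc n)} = insert (int n) {0..<int n}"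
      by auto
    then show ?case
      using Suc by (simp add: add.commute)
  qed simp
  moreover have "F (int M) = F 0"
    using assms by (simp add: grid_space_def) (metis add_0)
  ultimately show ?thesis
    by simp
qed

text \<open>Summation by parts: the sum of the two pointwise products is a discrete divergence
  \<open>F (l + 1) - F l\<close> of a periodic flux.\<close>

lemma curl4_adjoint:
  assumes v: "v \<in> grid_space M" and u: "u \<in> grid_space M"
  shows "grid_inner h M u (curl4 h v) = - grid_inner h M v (curl4_star h u)"
proof -
  \<comment> \<open>The narrow stencil leaves \<open>p (l + 1) - p l\<close> with
    \<open>p l = v l * u (l - 1)\<close>. The wide one leaves a two-step difference of
    \<open>v l * u (l - 2)\<close>, hence two consecutive terms in the flux, and a one-step
    difference of \<open>v (l - 1) * u l\<close>.\<close>
  define F where "F l = 9/8 * (v l * u (l - 1) / h)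
      - 1/24 * ((v (l + 1) * u (l - 1) + v l * u (l - 2) + v (l - 1) * u l) / h)" for l
  have "F \<in> grid_space M"
  proof -
    have v': "v (i + int M) = v i" and u': "u (i + int M) = u i" for i
      using v u by (simp_all add: grid_space_def)
    have "F (l + int M) = F l" for l
      using v'[of "l + 1"] v'[of "l - 1"] u'[of "l - 1"] u'[of "l - 2"]
      by (simp add: F_def v' u' algebra_simps)
    then show ?thesis
      by (simp add: grid_space_def)
  qed
  then have "0 = (\<Sum>l\<in>{0..<int M}. F (l + 1) - F l)"
    by (simp add: sum_telescope_periodic)
  also have "\<dots> = (\<Sum>l\<in>{0..<int M}. u l * curl4 h v l + v l * curl4_star h u l)"
  proof (rule sum.cong[OF refl])
    fix l :: int
    have "l + 1 + 1 = l + 2" "l + 1 - 2 = l - 1"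
      by simp_all
    then show "F (l + 1) - F l = u l * curl4 h v l + v l * curl4_star h u l"
      by (simp add: F_def curl4_def curl4_star_def add_divide_distrib diff_divide_distrib
          algebra_simps)
  qed
  finally have "h * (\<Sum>l\<in>{0..<int M}. u l * curl4 h v l + v l * curl4_star h u l) = 0"
    by simp
  then show ?thesis
    by (simp add: grid_inner_def sum.distrib distrib_left)
qed

lemma has_real_derivative_grid_inner_self:
  assumes "\<And>l. ((\<lambda>s. f s l) has_real_derivative f' l) (at t)"
  shows "((\<lambda>s. grid_inner h M (f s) (f s)) has_real_derivative 2 * grid_inner h M (f t) f') (at t)"
  unfolding grid_inner_def
  by (auto intro!: derivative_eq_intros assms simp: sum_distrib_left algebra_simps
      simp flip: mult_2)

lemma has_real_derivative_curl4:
  assumes "\<And>l. ((\<lambda>s. f s l) has_real_derivative f' l) (at t)"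
  shows "((\<lambda>s. curl4 h (f s) l) has_real_derivative curl4 h f' l) (at t)"
  unfolding curl4_def divide_inverse
  by (auto intro!: derivative_eq_intros assms simp: algebra_simps)

text \<open>\<open>deriv\<close> is total, so \<open>dt\<close> is a genuine derivative only where
  differentiability is known.\<close>

lemma has_real_derivative_dt:
  assumes "grid_differentiable_on E S" "t \<in> S"
  shows "((\<lambda>s. E s l) has_real_derivative dt E t l) (at t)"
  using assms unfolding grid_differentiable_on_def dt_def
  by (simp add: DERIV_deriv_iff_real_differentiable)

lemma grid_C1_imp_differentiable:
  "E \<in> grid_C1 M S \<Longrightarrow> grid_differentiable_on E S"
  by (auto simp: grid_C1_def grid_differentiable_on_def C1_differentiable_on_eq)

text \<open>Makes \<open>dt E t\<close> admissible in \<open>curl4_adjoint\<close>. Openness of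
  \<open>S\<close> supplies a neighbourhood of \<open>t\<close> on which \<open>E\<close> is
  periodic, so the shifted derivatives agree.\<close>

lemma dt_in_grid_space:
  assumes E: "E \<in> grid_C1 M S" and "open S" "t \<in> S"
  shows "dt E t \<in> grid_space M"
proof -
  have "deriv (\<lambda>s. E s (l + int M)) t = deriv (\<lambda>s. E s l) t" for l
  proof (rule deriv_cong_ev)
    show "\<forall>\<^sub>F s in nhds t. E s (l + int M) = E s l"
      using E eventually_nhds_in_open[OF \<open>open S\<close> \<open>t \<in> S\<close>]
      by (auto simp: grid_C1_def grid_space_def elim: eventually_mono)
  qed simp
  then show ?thesis
    by (simp add: grid_space_def dt_def)
qed

theorem theorem3:
  fixes \<epsilon>\<^sub>0 \<mu>\<^sub>0 \<omega>\<^sub>p\<^sub>e \<omega>\<^sub>p\<^sub>m c T L h :: real and M :: nat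
    and E K :: "real \<Rightarrow> grid_fun"
  assumes "\<epsilon>\<^sub>0 > 0" and "\<mu>\<^sub>0 > 0" and "\<omega>\<^sub>p\<^sub>e > 0" and "\<omega>\<^sub>p\<^sub>m > 0"
    and "c = 1 / sqrt (\<epsilon>\<^sub>0 * \<mu>\<^sub>0)"
    and "T > 0" and "L > 0" and "M \<ge> 1" and "h = L / real M"
    and "E \<in> grid_C1 M {0<..<T}" and "K \<in> grid_C1 M {0<..<T}"
    and "grid_differentiable_on (dt E) {0<..<T}" and "grid_differentiable_on (dt K) {0<..<T}"
    and "\<And>t l. t \<in> {0<..<T} \<Longrightarrow>
           dt (dt E) t l - c\<^sup>2 * curl4_star h (curl4 h (E t)) l + \<omega>\<^sub>p\<^sub>e\<^sup>2 * E t l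
             = c\<^sup>2 * curl4_star h (K t) l"
    and "\<And>t l. t \<in> {0<..<T} \<Longrightarrow>
           dt (dt K) t l + \<omega>\<^sub>p\<^sub>m\<^sup>2 * K t l = - \<omega>\<^sub>p\<^sub>m\<^sup>2 * curl4 h (E t) l"
  shows "\<forall>t\<in>{0<..<T}. (energy_EK h M c \<omega>\<^sub>p\<^sub>e \<omega>\<^sub>p\<^sub>m E K has_real_derivative 0) (at t)"
proof
  fix t assume t: "t \<in> {0<..<T}"
  have "h \<ge> 0"
    using assms(7,9) by simp
  have "c \<noteq> 0"
    using assms(1,2,5) by simp
  define W where "W s = (\<lambda>l. K s l + curl4 h (E s) l)" for s
  note E' = has_real_derivative_dt[OF grid_C1_imp_differentiable[OF assms(10)] t]
  note K' = has_real_derivative_dt[OF grid_C1_imp_differentiable[OF assms(11)] t]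
  note E'' = has_real_derivative_dt[OF assms(12) t]
  note K'' = has_real_derivative_dt[OF assms(13) t]
  have W': "((\<lambda>s. W s l) has_real_derivative dt K t l + curl4 h (dt E t) l) (at t)" for l
    unfolding W_def by (intro DERIV_add K' has_real_derivative_curl4 E')
  have W_space: "W t \<in> grid_space M"
    using t assms(10,11) curl4_in_grid_space[of "E t" M h]
    by (simp add: grid_C1_def grid_space_def W_def)
  have eqE: "dt (dt E) t = (\<lambda>l. c\<^sup>2 * curl4_star h (W t) l - \<omega>\<^sub>p\<^sub>e\<^sup>2 * E t l)"
    using assms(14)[OF t] by (auto simp: W_def curl4_star_add algebra_simps)
  have eqK: "dt (dt K) t = (\<lambda>l. (- \<omega>\<^sub>p\<^sub>m\<^sup>2) * W t l)"
  proof
    fix l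
    show "dt (dt K) t l = (- \<omega>\<^sub>p\<^sub>m\<^sup>2) * W t l"
      using assms(15)[OF t, of l] by (simp add: W_def algebra_simps)
  qed
  \<comment> \<open>Adjointness trades \<open>curl4_star\<close> on \<open>W t\<close> for
    \<open>curl4\<close> on \<open>dt E t\<close>, at the cost of a sign.\<close>
  have testE: "grid_inner h M (dt E t) (dt (dt E) t)
      = - c\<^sup>2 * grid_inner h M (W t) (curl4 h (dt E t)) - \<omega>\<^sub>p\<^sub>e\<^sup>2 * grid_inner h M (E t) (dt E t)"
    using dt_in_grid_space[OF assms(10) _ t] W_space
    by (simp add: eqE grid_inner_diff_right grid_inner_scale_right curl4_adjoint
        grid_inner_commute[of h M "E t"])
  have testK: "grid_inner h M (dt K t) (dt (dt K) t)
      = - \<omega>\<^sub>p\<^sub>m\<^sup>2 * grid_inner h M (W t) (dt K t)"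
    unfolding eqK grid_inner_scale_right by (simp add: grid_inner_commute)
  \<comment> \<open>Passing to quadratic forms avoids differentiating the square root in the norm,
    which fails at 0.\<close>
  have energy: "energy_EK h M c \<omega>\<^sub>p\<^sub>e \<omega>\<^sub>p\<^sub>m E K = (\<lambda>s. 1/2 *
      (1 / c\<^sup>2 * grid_inner h M (dt E s) (dt E s)
       + 1 / \<omega>\<^sub>p\<^sub>m\<^sup>2 * grid_inner h M (dt K s) (dt K s)
       + \<omega>\<^sub>p\<^sub>e\<^sup>2 / c\<^sup>2 * grid_inner h M (E s) (E s) + grid_inner h M (W s) (W s)))"
    by (simp add: fun_eq_iff energy_EK_def grid_norm_squared \<open>h \<ge> 0\<close> W_def)
  have "(energy_EK h M c \<omega>\<^sub>p\<^sub>e \<omega>\<^sub>p\<^sub>m E K has_real_derivative 1/2 *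
      (1 / c\<^sup>2 * (2 * grid_inner h M (dt E t) (dt (dt E) t))
       + 1 / \<omega>\<^sub>p\<^sub>m\<^sup>2 * (2 * grid_inner h M (dt K t) (dt (dt K) t))
       + \<omega>\<^sub>p\<^sub>e\<^sup>2 / c\<^sup>2 * (2 * grid_inner h M (E t) (dt E t))
       + 2 * grid_inner h M (W t) (\<lambda>l. dt K t l + curl4 h (dt E t) l))) (at t)"
    unfolding energy
    by (intro DERIV_cmult DERIV_add has_real_derivative_grid_inner_self E' K' E'' K'' W')
  then show "(energy_EK h M c \<omega>\<^sub>p\<^sub>e \<omega>\<^sub>p\<^sub>m E K has_real_derivative 0) (at t)"
    \<comment> \<open>After division by \<open>c\<^sup>2\<close> and
      \<open>\<omega>\<^sub>p\<^sub>m\<^sup>2\<close>, the tested equations cancel the potential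
      term in \<open>E t\<close> and both halves of the \<open>W t\<close> term.\<close>
    unfolding testE testK grid_inner_add_right
    using \<open>c \<noteq> 0\<close> assms(4) by (simp add: field_simps)
qed

end
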